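(* Let $2\le m\le n$ and let $\mathbf a_1,\dots,\mathbf a_m\in\mathbb R^n$ be non-zero-variance vectors. Then $$0\le r_{\mathbf a_1\mathbf a_2\cdots\mathbf a_m}^2\le 1\qquad\text{and}\qquad 0\le \omega_{\mathbf a_1\mathbf a_2\cdots\mathbf a_m}^2\le 1 .$$
   Context: For $\mathbf a=(a_1,\dots,a_n)^T\in\mathbb R^n$ let $\mu_{\mathbf a}=\frac1n\sum_{i=1}^n a_i$ and let $\mathbf 1$ be the all-ones vector; $\mathbf a$ is a non-zero-variance vector if $\mathbf a-\mu_{\mathbf a}\mathbf 1\neq 0$. In that case its standardized vector is $\mathbf a'=\frac{\mathbf a-\mu_{\mathbf a}\mathbf 1}{\|\mathbf a-\mu_{\mathbf a}\mathbf 1\|}$ (Euclidean norm). For non-zero-variance vectors $\mathbf a_1,\dots,\mathbf a_m\in\mathbb R^n$ ($2\le m\le n$) with standardized vectors $\mathbf a_i'=(a'_{i1},\dots,a'_{in})^T$, and for $1\le j_1<\cdots<j_m\le n$, let $[\mathbf a'(m)\,|\,j_1,\dots,j_m]$ be the $m\times m$ matrix with $(i,k)$ entry $a'_{i j_k}$. The quantities $\omega_{\mathbf a_1\cdots\mathbf a_m}^2$ (squared unsigned incorrelation coefficient) and $r_{\mathbf a_1\cdots\mathbf a_m}^2$ (squared unsigned correlation coefficient) denote the real numbers $$\omega_{\mathbf a_1\cdots\mathbf a_m}^2=\sum_{1\le j_1<\cdots<j_m\le n}\bigl(\det[\mathbf a'(m)\,|\,j_1,\dots,j_m]\bigr)^2,\qquad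 r_{\mathbf a_1\cdots\mathbf a_m}^2=1-\sum_{1\le j_1<\cdots<j_m\le n}\bigl(\det[\mathbf a'(m)\,|\,j_1,\dots,j_m]\bigr)^2 .$$ *)

theory Defs
  imports Complex_Main "Jordan_Normal_Form.Determinant"
begin

definition ones_vec :: "nat \<Rightarrow> real vec" where
  "ones_vec n = vec n (\<lambda>_. 1)"

definition mean_vec :: "real vec \<Rightarrow> real" where
  "mean_vec v = (\<Sum>i<dim_vec v. v $ i) / real (dim_vec v)"

definition centered_vec :: "real vec \<Rightarrow> real vec" where
  "centered_vec v = v - mean_vec v \<cdot>\<^sub>v ones_vec (dim_vec v)"

definition nonzero_variance :: "real vec \<Rightarrow> bool" where
  "nonzero_variance v \<longleftrightarrow> centered_vec v \<noteq> 0\<^sub>v (dim_vec v)"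

definition euclidean_norm_vec :: "real vec \<Rightarrow> real" where
  "euclidean_norm_vec v = sqrt (v \<bullet> v)"

definition standardized_vec :: "real vec \<Rightarrow> real vec" where
  "standardized_vec v = (1 / euclidean_norm_vec (centered_vec v)) \<cdot>\<^sub>v centered_vec v"

(* Column selections j_1 < ... < j_m, shifted to the 0-based range {0..<n}. *)
definition increasing_indices :: "nat \<Rightarrow> nat \<Rightarrow> nat list set" where
  "increasing_indices n m = {js. length js = m \<and> sorted_wrt (<) js \<and> set js \<subseteq> {..<n}}"

(* The vectors are a 0, ..., a (m - 1); the values of a at indices >= m are irrelevant here
   and in the two coefficients below. *)
definition standardized_minor_mat :: "nat \<Rightarrow> (nat \<Rightarrow> real vec) \<Rightarrow> nat list \<Rightarrow> real mat" where
  "standardized_minor_mat m a js = mat m m (\<lambda>(i, k). standardized_vec (a i) $ (js ! k))"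

definition incorrelation_sq :: "nat \<Rightarrow> nat \<Rightarrow> (nat \<Rightarrow> real vec) \<Rightarrow> real" where
  "incorrelation_sq n m a =
     (\<Sum>js\<in>increasing_indices n m. (det (standardized_minor_mat m a js))\<^sup>2)"

definition correlation_sq :: "nat \<Rightarrow> nat \<Rightarrow> (nat \<Rightarrow> real vec) \<Rightarrow> real" where
  "correlation_sq n m a =
     1 - (\<Sum>js\<in>increasing_indices n m. (det (standardized_minor_mat m a js))\<^sup>2)"

end

theory Submission
  imports Defs
begin

text \<open>
  By the Cauchy-Binet formula the sum of the squared maximal minors is the Gram determinant of the
  standardized vectors. These are unit vectors, so Hadamard's inequality bounds it by 1.
\<close>

section \<open>Increasing index lists and injective maps\<close>

text \<open>A strictly increasing list is the sorted enumeration of its own set of entries. The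
  subset form yields finiteness, and later the list belonging to the image of an injective
  map.\<close>

lemma increasing_indices_iff:
  "js \<in> increasing_indices n m \<longleftrightarrow>
     (\<exists>S. S \<subseteq> {..<n} \<and> card S = m \<and> js = sorted_list_of_set S)"
proof
  assume js: "js \<in> increasing_indices n m"
  then have "js = sorted_list_of_set (set js)"
    by (metis (no_types, lifting) increasing_indices_def mem_Collect_eq
        sorted_list_of_set.idem_if_sorted_distinct strict_sorted_iff)
  moreover from js have "card (set js) = m"
    by (auto simp: increasing_indices_def strict_sorted_iff distinct_card)
  ultimately show "\<exists>S. S \<subseteq> {..<n} \<and> card S = m \<and> js = sorted_list_of_set S"
    using js by (auto simp: increasing_indices_def)
next
  assume "\<exists>S. S \<subseteq> {..<n} \<and> card S = m \<and> js = sorted_list_of_set S"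
  then show "js \<in> increasing_indices n m"
    by (auto simp: increasing_indices_def finite_subset[of _ "{..<n}"] subset_iff
        simp del: sorted_list_of_set.idem_if_sorted_distinct)
qed

lemma finite_increasing_indices: "finite (increasing_indices n m)"
  by (rule finite_subset[of _ "sorted_list_of_set ` Pow {..<n}"]) (auto simp: increasing_indices_iff)

text \<open>
  The values outside \<open>{0..<m}\<close> are pinned to the identity because this is the index set
  produced by \<open>det_linear_rows_sum\<close>.
\<close>

lemma bij_betw_increasing_permutes:
  "bij_betw (\<lambda>(js, p) i. if i < m then js ! p i else i)
     (increasing_indices n m \<times> {p. p permutes {0..<m}})
     {f. (\<forall>i\<in>{0..<m}. f i \<in> {0..<n}) \<and> (\<forall>i. i \<notin> {0..<m} \<longrightarrow> f i = i) \<and> inj_on f {0..<m}}"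
  (is "bij_betw ?h ?D ?F")
proof -
  have nth_bij: "bij_betw (nth js) {0..<m} (set js)" and len: "length js = m"
    and dist: "distinct js" and sub: "set js \<subseteq> {0..<n}"
    if "js \<in> increasing_indices n m" for js
    using that by (auto simp: increasing_indices_def strict_sorted_iff intro!: bij_betw_nth)
  have img: "?h (js, p) ` {0..<m} = set js"
    and inj: "inj_on (?h (js, p)) {0..<m}"
    if js: "js \<in> increasing_indices n m" and p: "p permutes {0..<m}" for js p
  proof -
    \<comment> \<open>Permuting positions does not change which entries are listed, so the image of
      \<open>{0..<m}\<close> still reveals \<open>set js\<close>.\<close>
    have "bij_betw (nth js \<circ> p) {0..<m} (set js)"
      using permutes_imp_bij[OF p] nth_bij[OF js] by (rule bij_betw_trans)
    then have "bij_betw (?h (js, p)) {0..<m} (set js)"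
      by (rule bij_betw_cong[THEN iffD1, rotated]) auto
    then show "?h (js, p) ` {0..<m} = set js" "inj_on (?h (js, p)) {0..<m}"
      by (auto simp: bij_betw_def)
  qed
  show ?thesis
  proof (rule bij_betwI')
    fix x y assume xy: "x \<in> ?D" "y \<in> ?D"
    obtain js p ks q where x: "x = (js, p)" and y: "y = (ks, q)" by fastforce
    have D: "js \<in> increasing_indices n m" "ks \<in> increasing_indices n m"
      "p permutes {0..<m}" "q permutes {0..<m}" using xy x y by auto
    show "(?h x = ?h y) = (x = y)"
    proof
      assume eq: "?h x = ?h y"
      \<comment> \<open>The common image determines the sorted list; distinctness of its entries
        then recovers the permutation.\<close>
      then have "set js = set ks"
        using img[OF D(1,3)] img[OF D(2,4)] by (simp add: x y)
      with D have jk: "js = ks"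
        by (auto simp: increasing_indices_def intro: strict_sorted_equal)
      have "p i = q i" for i
      proof (cases "i < m")
        case True
        from fun_cong[OF eq, of i] True have "js ! p i = js ! q i" by (simp add: x y jk)
        moreover have "p i < m" "q i < m"
          using permutes_in_image[OF D(3), of i] permutes_in_image[OF D(4), of i] True by auto
        ultimately show ?thesis
          using dist[OF D(1)] len[OF D(1)] by (simp add: nth_eq_iff_index_eq)
      next
        case False
        then show ?thesis using D(3,4) by (simp add: permutes_not_in)
      qed
      with jk show "x = y" by (auto simp: x y)
    qed simp
  next
    fix x assume x: "x \<in> ?D"
    obtain js p where xp: "x = (js, p)" by fastforce
    have D: "js \<in> increasing_indices n m" "p permutes {0..<m}" using x xp by auto
    have "\<forall>i\<in>{0..<m}. ?h x i \<in> {0..<n}"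
      using img[OF D] sub[OF D(1)] unfolding xp by blast
    then show "?h x \<in> ?F" using inj[OF D] unfolding xp by auto
  next
    fix f assume f: "f \<in> ?F"
    \<comment> \<open>An injective \<open>f\<close> factors through its sorted image:
      \<open>p i\<close> below is the position of \<open>f i\<close> in \<open>js\<close>.\<close>
    define js where "js = sorted_list_of_set (f ` {0..<m})"
    have js: "js \<in> increasing_indices n m"
      unfolding increasing_indices_iff js_def
      using f by (intro exI[of _ "f ` {0..<m}"]) (auto simp: card_image)
    have set: "set js = f ` {0..<m}" by (simp add: js_def)
    define p where "p i = (if i < m then inv_into {0..<m} (nth js) (f i) else i)" for i
    have "bij_betw f {0..<m} (set js)" using f set by (auto simp: bij_betw_def)
    then have "bij_betw (inv_into {0..<m} (nth js) \<circ> f) {0..<m} {0..<m}"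
      using bij_betw_inv_into[OF nth_bij[OF js]] by (rule bij_betw_trans)
    then have "bij_betw p {0..<m} {0..<m}"
      by (rule bij_betw_cong[THEN iffD1, rotated]) (auto simp: p_def)
    then have p: "p permutes {0..<m}"
      by (rule bij_imp_permutes) (auto simp: p_def)
    have "f i = ?h (js, p) i" for i
      using f set nth_bij[OF js] by (auto simp: p_def bij_betw_def f_inv_into_f)
    then show "\<exists>x\<in>?D. f = ?h x" using js p by blast
  qed
qed

section \<open>The Cauchy-Binet formula\<close>

text \<open>Each row of \<open>A * B\<close> is a combination of rows of \<open>B\<close>, so
  multilinearity expands the determinant over all maps \<open>f\<close> choosing one row of
  \<open>B\<close> per row. Only injective \<open>f\<close> survive. They factor uniquely into an
  increasing list and a permutation, and summing over the permutations produces the minor of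
  \<open>A\<close>.\<close>

theorem Cauchy_Binet:
  fixes A B :: "'a :: comm_ring_1 mat"
  assumes A: "A \<in> carrier_mat m n" and B: "B \<in> carrier_mat n m"
  shows "det (A * B) = (\<Sum>js\<in>increasing_indices n m.
    det (mat m m (\<lambda>(i, k). A $$ (i, js ! k))) * det (mat m m (\<lambda>(k, j). B $$ (js ! k, j))))"
proof -
  let ?F = "{f. (\<forall>i\<in>{0..<m}. f i \<in> {0..<n}) \<and> (\<forall>i. i \<notin> {0..<m} \<longrightarrow> f i = i)}"
  let ?I = "{f. (\<forall>i\<in>{0..<m}. f i \<in> {0..<n}) \<and> (\<forall>i. i \<notin> {0..<m} \<longrightarrow> f i = i) \<and> inj_on f {0..<m}}"
  let ?P = "{p. p permutes {0..<m}}"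
  let ?R = "\<lambda>f. det (mat\<^sub>r m m (\<lambda>i. row B (f i)))"
  let ?t = "\<lambda>f. (\<Prod>i = 0..<m. A $$ (i, f i)) * ?R f"
  have "det (A * B) = (\<Sum>f\<in>?F. det (mat\<^sub>r m m (\<lambda>i. A $$ (i, f i) \<cdot>\<^sub>v row B (f i))))"
    unfolding mat_mul_finsum_alt[OF A B]
    by (rule det_linear_rows_sum) (use B in auto)
  also have "\<dots> = (\<Sum>f\<in>?F. ?t f)"
    by (intro sum.cong refl det_rows_mul) (use B in auto)
  also have "\<dots> = (\<Sum>f\<in>?I. ?t f)"
  proof (rule sum.mono_neutral_right)
    show "finite ?F" by (rule finite_bounded_functions) auto
    \<comment> \<open>A non-injective choice repeats a row of \<open>B\<close>.\<close>
    show "\<forall>f\<in>?F - ?I. ?t f = 0"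
    proof
      fix f assume "f \<in> ?F - ?I"
      then obtain i j where "i < m" "j < m" "i \<noteq> j" "f i = f j" by (auto simp: inj_on_def)
      then have "?R f = 0"
        by (intro det_identical_rows[of _ m i j]) (auto intro!: eq_vecI simp: mat_of_rows_def)
      then show "?t f = 0" by simp
    qed
  qed auto
  also have "\<dots> = (\<Sum>(js, p)\<in>increasing_indices n m \<times> ?P.
      ?t (\<lambda>i. if i < m then js ! p i else i))"
    by (subst sum.reindex_bij_betw[OF bij_betw_increasing_permutes, symmetric])
       (simp add: case_prod_unfold)
  also have "\<dots> = (\<Sum>js\<in>increasing_indices n m. \<Sum>p\<in>?P.
      ?t (\<lambda>i. if i < m then js ! p i else i))"
    by (rule sum.cartesian_product[symmetric])
  also have "\<dots> = (\<Sum>js\<in>increasing_indices n m.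
    det (mat m m (\<lambda>(i, k). A $$ (i, js ! k))) * det (mat m m (\<lambda>(k, j). B $$ (js ! k, j))))"
  proof (rule sum.cong[OF refl])
    fix js assume js: "js \<in> increasing_indices n m"
    let ?M = "mat m m (\<lambda>(k, j). B $$ (js ! k, j))"
    let ?N = "mat m m (\<lambda>(i, k). A $$ (i, js ! k))"
    \<comment> \<open>For fixed \<open>js\<close>, the chosen rows of \<open>B\<close> are those of
      \<open>?M\<close> permuted by \<open>p\<close>. The resulting sign is the one in the Leibniz
      expansion of \<open>det ?N\<close>.\<close>
    have "?t (\<lambda>i. if i < m then js ! p i else i)
      = (signof p * (\<Prod>i = 0..<m. ?N $$ (i, p i))) * det ?M" if p: "p \<in> ?P" for p
    proof -
      have pm: "p i < m" if "i < m" for i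
        using permutes_in_image[of p "{0..<m}" i] p that by auto
      have jm: "js ! k < n" if "k < m" for k
        using js that nth_mem[of k js] unfolding increasing_indices_def by blast
      have "mat\<^sub>r m m (\<lambda>i. row B (if i < m then js ! p i else i))
        = mat m m (\<lambda>(i, j). ?M $$ (p i, j))"
        by (rule eq_matI) (use B pm jm in auto)
      then have "?R (\<lambda>i. if i < m then js ! p i else i) = signof p * det ?M"
        using det_permute_rows[of ?M m p] p by simp
      moreover have "(\<Prod>i = 0..<m. A $$ (i, if i < m then js ! p i else i))
        = (\<Prod>i = 0..<m. ?N $$ (i, p i))"
        by (rule prod.cong) (auto simp: pm)
      ultimately show ?thesis by (simp add: ac_simps)
    qed
    then have "(\<Sum>p\<in>?P. ?t (\<lambda>i. if i < m then js ! p i else i))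
      = (\<Sum>p\<in>?P. signof p * (\<Prod>i = 0..<m. ?N $$ (i, p i))) * det ?M"
      by (simp add: sum_distrib_right)
    then show "(\<Sum>p\<in>?P. ?t (\<lambda>i. if i < m then js ! p i else i)) = det ?N * det ?M"
      using det_def'[of ?N m] by simp
  qed
  finally show ?thesis .
qed

section \<open>Hadamard's inequality for Gram determinants\<close>

text \<open>Induction by one Gram-Schmidt step: making the later vectors orthogonal to
  \<open>u 0\<close> keeps the determinant, splits off the factor \<open>u 0 \<bullet> u 0\<close>,
  and lengthens no vector. The family \<open>u\<close> is generalized because the induction
  hypothesis is applied to the projected family \<open>w\<close>.\<close>

theorem Hadamard_Gram:
  fixes u :: "nat \<Rightarrow> real vec"
  assumes "\<And>i. i < m \<Longrightarrow> u i \<in> carrier_vec n"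
  shows "det (mat m m (\<lambda>(i, j). u i \<bullet> u j)) \<le> (\<Prod>i<m. u i \<bullet> u i)"
  using assms
proof (induction m arbitrary: u)
  case 0
  then show ?case by (simp add: det_def)
next
  case (Suc m)
  let ?G = "mat (Suc m) (Suc m) (\<lambda>(i, j). u i \<bullet> u j)"
  have nonneg: "0 \<le> v \<bullet> v" for v :: "real vec"
    by (simp add: scalar_prod_def sum_nonneg)
  have u0: "u 0 \<in> carrier_vec n" using Suc.prems by simp
  show ?case
  \<comment> \<open>In the degenerate case \<open>u 0\<close> is the zero vector and the first row
    of \<open>?G\<close> vanishes; otherwise the division in \<open>d\<close> is legitimate.\<close>
  proof (cases "u 0 \<bullet> u 0 = 0")
    case True
    then have "\<forall>k<n. u 0 $ k = 0"
      using u0 by (auto simp: scalar_prod_def sum_nonneg_eq_0_iff)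
    then have "u 0 \<bullet> u j = 0" if "j < Suc m" for j
      using Suc.prems[OF that] by (auto simp: scalar_prod_def)
    then have "det ?G = 0"
      by (subst laplace_expansion_row[of _ "Suc m" 0]) auto
    then show ?thesis by (simp add: prod_nonneg nonneg)
  next
    case False
    \<comment> \<open>\<open>d i\<close> is the coefficient of the orthogonal projection of
      \<open>u i\<close> onto \<open>u 0\<close>. The index of \<open>w\<close> is shifted by one
      because \<open>u 0\<close> itself is dropped.\<close>
    define d where "d i = (u i \<bullet> u 0) / (u 0 \<bullet> u 0)" for i
    define w where "w i = u (Suc i) - d (Suc i) \<cdot>\<^sub>v u 0" for i
    \<comment> \<open>\<open>L\<close> replaces every later row of \<open>?G\<close> by the row of inner products with the component
      orthogonal to \<open>u 0\<close>.\<close>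
    define L :: "real mat" where "L = mat (Suc m) (Suc m)
      (\<lambda>(i, k). (if k = i then 1 else 0) - (if k = 0 then (if i = 0 then 0 else d i) else 0))"
    have L: "L \<in> carrier_mat (Suc m) (Suc m)" by (simp add: L_def)
    \<comment> \<open>\<open>L\<close> is lower triangular with unit diagonal: its only off-diagonal
      entries are \<open>- d i\<close> in column 0.\<close>
    have "det L = prod_list (diag_mat L)"
      by (rule det_lower_triangular[OF _ L]) (auto simp: L_def)
    also have "\<dots> = 1"
      unfolding prod_list_diag_prod by (rule prod.neutral) (auto simp: L_def)
    finally have detL: "det L = 1" .
    have wc: "w i \<in> carrier_vec n" if "i < m" for i
      using Suc.prems[of "Suc i"] u0 that by (auto simp: w_def)
    have wu: "w i \<bullet> u j = u (Suc i) \<bullet> u j - d (Suc i) * (u 0 \<bullet> u j)"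
      if "i < m" "j < Suc m" for i j
      using Suc.prems[of "Suc i"] Suc.prems[of j] u0 that
      by (simp add: w_def minus_scalar_prod_distrib[of _ n])
    have w0: "w i \<bullet> u 0 = 0" if "i < m" for i
      using wu[OF that, of 0] False by (simp add: d_def)
    \<comment> \<open>Since \<open>w i\<close> is orthogonal to \<open>u 0\<close>, projecting the
      second argument changes nothing. Row operations alone therefore already give the Gram matrix
      of \<open>w\<close>.\<close>
    have ww: "w i \<bullet> w j = w i \<bullet> u (Suc j)" if "i < m" "j < m" for i j
      using Suc.prems[of "Suc j"] wc[OF that(1)] u0 w0[OF that(1)] that
      by (simp add: w_def[of j] scalar_prod_minus_distrib[of _ n])
    have LG: "(L * ?G) $$ (i, j) = u i \<bullet> u j - (if i = 0 then 0 else d i) * (u 0 \<bullet> u j)"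
      if "i < Suc m" "j < Suc m" for i j
    proof -
      \<comment> \<open>The sum is split into two deltas, at \<open>k = i\<close> and
        \<open>k = 0\<close>, so that the case \<open>i = 0\<close> needs no separate
        treatment.\<close>
      have "(L * ?G) $$ (i, j) = (\<Sum>k = 0..<Suc m. (if k = i then u k \<bullet> u j else 0)
          - (if k = 0 then (if i = 0 then 0 else d i) * (u k \<bullet> u j) else 0))"
        using that L by (auto simp: scalar_prod_def L_def intro!: sum.cong)
      also have "\<dots> = u i \<bullet> u j - (if i = 0 then 0 else d i) * (u 0 \<bullet> u j)"
        using that by (simp only: sum_subtractf sum.delta finite_atLeastLessThan) simp
      finally show ?thesis .
    qed
    let ?W = "mat m m (\<lambda>(i, j). w i \<bullet> w j)"
    \<comment> \<open>The lower left block holds the products \<open>w i \<bullet> u 0\<close>,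
      which are zero.\<close>
    have "L * ?G = four_block_mat (mat 1 1 (\<lambda>_. u 0 \<bullet> u 0)) (mat 1 m (\<lambda>(i, j). u 0 \<bullet> u (Suc j)))
      (0\<^sub>m m 1) ?W"
      (is "_ = ?Q")
    proof (rule eq_matI)
      fix i j assume "i < dim_row ?Q" "j < dim_col ?Q"
      then have ij: "i < Suc m" "j < Suc m" by auto
      show "(L * ?G) $$ (i, j) = ?Q $$ (i, j)"
      proof (cases i)
        case 0
        then show ?thesis using ij by (subst LG) (cases j; simp)+
      next
        case (Suc i')
        then have "(L * ?G) $$ (i, j) = w i' \<bullet> u j"
          using ij by (subst LG) (auto simp: wu)
        then show ?thesis using ij Suc by (cases j) (auto simp: w0 ww)
      qed
    qed (use L in auto)
    moreover have "det (L * ?G) = det ?G"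
      using detL by (subst det_mult[OF L]) auto
    ultimately have "det ?G = (u 0 \<bullet> u 0) * det ?W"
      by (simp add: det_four_block_mat_lower_left_zero[of _ 1 _ m] det_single)
    also have "\<dots> \<le> (u 0 \<bullet> u 0) * (\<Prod>i<m. w i \<bullet> w i)"
      by (intro mult_left_mono Suc.IH nonneg wc)
    also have "\<dots> \<le> (u 0 \<bullet> u 0) * (\<Prod>i<m. u (Suc i) \<bullet> u (Suc i))"
    proof (intro mult_left_mono prod_mono conjI nonneg)
      fix i assume "i \<in> {..<m}"
      then have i: "i < m" by simp
      have "u 0 \<bullet> u (Suc i) = u (Suc i) \<bullet> u 0"
        using u0 Suc.prems[of "Suc i"] i by (intro comm_scalar_prod[of _ n]) auto
      \<comment> \<open>Pythagoras: the subtracted term is the squared length of the projection onto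
        \<open>u 0\<close>.\<close>
      then have "w i \<bullet> w i = u (Suc i) \<bullet> u (Suc i) - (u (Suc i) \<bullet> u 0)\<^sup>2 / (u 0 \<bullet> u 0)"
        using i by (simp add: ww wu d_def power2_eq_square)
      then show "w i \<bullet> w i \<le> u (Suc i) \<bullet> u (Suc i)"
        using nonneg[of "u 0"] by simp
    qed
    finally show ?thesis
      by (simp only: prod.lessThan_Suc_shift)
  qed
qed

section \<open>Standardized vectors and the coefficient bounds\<close>

lemma standardized_vec_carrier:
  "a \<in> carrier_vec n \<Longrightarrow> standardized_vec a \<in> carrier_vec n"
  by (auto simp: standardized_vec_def centered_vec_def ones_vec_def)

lemma standardized_vec_unit:
  assumes "nonzero_variance a"
  shows "standardized_vec a \<bullet> standardized_vec a = 1"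
proof -
  define c where "c = centered_vec a"
  have "dim_vec c = dim_vec a" by (simp add: c_def centered_vec_def ones_vec_def)
  with assms have "c \<noteq> 0\<^sub>v (dim_vec c)" by (simp add: nonzero_variance_def c_def)
  then obtain k where k: "k < dim_vec c" "c $ k \<noteq> 0" by (auto simp: vec_eq_iff)
  \<comment> \<open>A single nonzero coordinate makes the sum of squares positive, so the
    normalizing factor does not divide by zero.\<close>
  have "0 < c \<bullet> c"
    unfolding scalar_prod_def using k
    by (intro sum_pos2[of _ k]) (auto simp: zero_less_mult_iff)
  then have "(1 / sqrt (c \<bullet> c)) * ((1 / sqrt (c \<bullet> c)) * (c \<bullet> c)) = 1"
    by (simp add: real_div_sqrt)
  then show ?thesis
    by (simp add: standardized_vec_def euclidean_norm_vec_def flip: c_def)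
qed

text \<open>With the standardized vectors as rows of \<open>A\<close>, the entries of
  \<open>A * A\<^sup>T\<close> are their inner products. Cauchy-Binet then pairs each maximal minor
  of \<open>A\<close> with its own transpose, which gives the squares.\<close>

lemma incorrelation_sq_eq_Gram:
  assumes "\<And>i. i < m \<Longrightarrow> a i \<in> carrier_vec n"
  shows "incorrelation_sq n m a =
    det (mat m m (\<lambda>(i, j). standardized_vec (a i) \<bullet> standardized_vec (a j)))"
proof -
  define A where "A = mat m n (\<lambda>(i, j). standardized_vec (a i) $ j)"
  have A: "A \<in> carrier_mat m n" by (simp add: A_def)
  have "dim_vec (standardized_vec (a i)) = n" if "i < m" for i
    using standardized_vec_carrier[OF assms[OF that]] by simp
  then have "mat m m (\<lambda>(i, j). standardized_vec (a i) \<bullet> standardized_vec (a j)) = A * A\<^sup>T"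
    by (intro eq_matI) (auto simp: A_def scalar_prod_def)
  also have "det \<dots> = (\<Sum>js\<in>increasing_indices n m. (det (standardized_minor_mat m a js))\<^sup>2)"
    unfolding Cauchy_Binet[OF A transpose_carrier_mat[THEN iffD2, OF A]]
  proof (rule sum.cong[OF refl])
    fix js assume "js \<in> increasing_indices n m"
    then have jm: "js ! k < n" if "k < m" for k
      using that nth_mem[of k js] unfolding increasing_indices_def by blast
    let ?S = "standardized_minor_mat m a js"
    have S: "?S \<in> carrier_mat m m" by (simp add: standardized_minor_mat_def)
    have "mat m m (\<lambda>(i, k). A $$ (i, js ! k)) = ?S"
      by (rule eq_matI) (auto simp: A_def standardized_minor_mat_def jm)
    moreover have "mat m m (\<lambda>(k, j). A\<^sup>T $$ (js ! k, j)) = ?S\<^sup>T"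
      by (rule eq_matI) (auto simp: A_def standardized_minor_mat_def jm)
    ultimately show "det (mat m m (\<lambda>(i, k). A $$ (i, js ! k)))
        * det (mat m m (\<lambda>(k, j). A\<^sup>T $$ (js ! k, j))) = (det ?S)\<^sup>2"
      by (simp add: det_transpose[OF S] power2_eq_square)
  qed
  finally show ?thesis by (simp add: incorrelation_sq_def)
qed

theorem mainTheorem4:
  fixes m n :: nat and a :: "nat \<Rightarrow> real vec"
  assumes "2 \<le> m" and "m \<le> n"
    and "\<And>i. i < m \<Longrightarrow> a i \<in> carrier_vec n"
    and "\<And>i. i < m \<Longrightarrow> nonzero_variance (a i)"
  shows "0 \<le> correlation_sq n m a \<and> correlation_sq n m a \<le> 1 \<and>
         0 \<le> incorrelation_sq n m a \<and> incorrelation_sq n m a \<le> 1"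
proof -
  \<comment> \<open>This upper bound is the only substantial inequality: nonnegativity is that of a
    sum of squares, and the two coefficients add up to 1.\<close>
  have "incorrelation_sq n m a \<le> (\<Prod>i<m. standardized_vec (a i) \<bullet> standardized_vec (a i))"
    using incorrelation_sq_eq_Gram[of m a n, OF assms(3)]
      Hadamard_Gram[of m "\<lambda>i. standardized_vec (a i)" n] standardized_vec_carrier[OF assms(3)]
    by simp
  also have "\<dots> = 1" by (rule prod.neutral) (simp add: standardized_vec_unit assms(4))
  finally have "incorrelation_sq n m a \<le> 1" .
  moreover have "0 \<le> incorrelation_sq n m a" by (simp add: incorrelation_sq_def sum_nonneg)
  moreover have "correlation_sq n m a = 1 - incorrelation_sq n m a"
    by (simp add: correlation_sq_def incorrelation_sq_def)
  ultimately show ?thesis by simp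
qed

end
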